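(* Let $G$ be a connected graph of order $n$. If $\sigma_2(G)\ge n-k+1$ for some positive integer $k$, then $G$ has a spanning tree with at most $(k-1)/2$ branch vertices.
   Context: All graphs are finite, undirected, without loops or multiple edges. For a graph $G$, $\sigma_2(G)$ denotes the minimum of $d_G(u)+d_G(v)$ over all pairs of distinct nonadjacent vertices $u,v$ of $G$; if $G$ has no two nonadjacent vertices (i.e. $G$ is complete), $\sigma_2(G)=+\infty$. A branch vertex of a tree $T$ is a vertex of degree at least three in $T$. *)

theory Defs
  imports "Graph_Theory.Graph_Theory" "HOL-Library.Extended_Real"
begin

text \<open>
  A finite simple undirected graph is a \<^locale>\<open>pair_graph\<close>: a finite vertex set together with a
  symmetric, irreflexive set of pairs of vertices. Each undirected edge is represented by its two
  orientations, so the undirected degree of a vertex is its out-degree.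
\<close>

abbreviation deg :: "'a pair_pre_digraph \<Rightarrow> 'a \<Rightarrow> nat" where
  "deg G v \<equiv> out_degree (with_proj G) v"

text \<open>The infimum of the empty set is \<open>\<infinity>\<close>, which is the convention for complete graphs.\<close>

definition sigma2 :: "'a pair_pre_digraph \<Rightarrow> ereal" where
  "sigma2 G = Inf {ereal (real (deg G u + deg G v)) | u v.
     u \<in> pverts G \<and> v \<in> pverts G \<and> u \<noteq> v \<and> (u, v) \<notin> parcs G}"

text \<open>
  The library predicates \<open>forest\<close>, \<open>tree\<close> and \<open>spanning_tree\<close> speak about directed cycles and are
  unusable here: in a symmetric digraph, an arc followed by its reverse is a directed cycle of
  length 2. A cycle of the undirected graph is a directed cycle of length at least 3.
\<close>

definition undirected_tree :: "'a pair_pre_digraph \<Rightarrow> bool" where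
  "undirected_tree T \<longleftrightarrow> pair_graph T \<and> Digraph_Component.connected (with_proj T) \<and>
     \<not> (\<exists>p. pre_digraph.cycle (with_proj T) p \<and> 3 \<le> length p)"

definition undirected_spanning_tree :: "'a pair_pre_digraph \<Rightarrow> 'a pair_pre_digraph \<Rightarrow> bool" where
  "undirected_spanning_tree T G \<longleftrightarrow> undirected_tree T \<and> spanning (with_proj T) (with_proj G)"

definition branch_vertices :: "'a pair_pre_digraph \<Rightarrow> 'a set" where
  "branch_vertices T = {v \<in> pverts T. 3 \<le> deg T v}"

end

theory Submission
  imports Defs
begin

text \<open>
  Among all spanning trees choose \<open>T\<close> with the fewest branch vertices and, subject to that, the
  fewest leaves; assume it has \<open>b > 0\<close> branch vertices. Exchanging edges along a cycle shows that the
  leaves of \<open>T\<close> are pairwise nonadjacent in \<open>G\<close>. If \<open>u\<close> is a leaf and \<open>T\<close> is rooted at \<open>u\<close>, then for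
  every neighbour \<open>x\<close> of \<open>u\<close> in \<open>G\<close> the parent of \<open>x\<close> is \<open>u\<close> or has degree 2 in \<open>T\<close>, and replacing the
  edge from \<open>x\<close> to its parent by \<open>xu\<close> turns the parent into a leaf of another optimal tree. So the
  parents of the neighbours of \<open>u\<close> are distinct and nonadjacent to every other leaf \<open>v\<close>.

  Call a branch vertex \<open>w\<close> an end branch if the other branch vertices lie in one component of
  \<open>T - w\<close>, and choose \<open>(T, w)\<close> with \<open>w\<close> of minimum degree. A leaf \<open>v\<close> on a pendant path at \<open>w\<close> is
  adjacent in \<open>G\<close> to no branch vertex \<open>x \<noteq> w\<close>, since otherwise the pendant path could be moved from
  \<open>w\<close> to \<open>x\<close>. Hence the parents of the neighbours of \<open>u\<close>, the neighbours of \<open>v\<close>, the leaves other than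
  \<open>u\<close>, and the branch vertices other than \<open>w\<close> are disjoint sets. As \<open>T\<close> has at least \<open>b + 2\<close> leaves,
  \<open>deg u + deg v + 2 b \<le> n\<close>.
\<close>

section \<open>Trees as symmetric relations\<close>

definition edge :: "'a \<Rightarrow> 'a \<Rightarrow> 'a rel" where
  "edge x y = {(x, y), (y, x)}"

definition connected_on :: "'a set \<Rightarrow> 'a rel \<Rightarrow> bool" where
  "connected_on V E \<longleftrightarrow>
     finite V \<and> V \<noteq> {} \<and> E \<subseteq> V \<times> V \<and> sym E \<and> irrefl E \<and> (\<forall>x\<in>V. \<forall>y\<in>V. (x, y) \<in> E\<^sup>*)"

text \<open>Each undirected edge contributes both orientations, hence the factor 2.\<close>

definition tree_on :: "'a set \<Rightarrow> 'a rel \<Rightarrow> bool" where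
  "tree_on V T \<longleftrightarrow> connected_on V T \<and> card T = 2 * (card V - 1)"

text \<open>A parent function \<open>p\<close> is only meaningful on \<open>V - {r}\<close>; \<open>d\<close> merely decreases towards the root.\<close>

definition up :: "'a set \<Rightarrow> 'a \<Rightarrow> ('a \<Rightarrow> 'a) \<Rightarrow> 'a rel" where
  "up V r p = {(x, p x) | x. x \<in> V - {r}}"

definition rooted :: "'a set \<Rightarrow> 'a \<Rightarrow> ('a \<Rightarrow> 'a) \<Rightarrow> ('a \<Rightarrow> nat) \<Rightarrow> bool" where
  "rooted V r p d \<longleftrightarrow> r \<in> V \<and> (\<forall>x\<in>V - {r}. p x \<in> V \<and> d (p x) < d x)"

lemma in_edge_iff: "(a, b) \<in> edge x y \<longleftrightarrow> a = x \<and> b = y \<or> a = y \<and> b = x"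
  by (auto simp: edge_def)

lemma sym_edge: "sym (edge x y)"
  by (auto simp: sym_def edge_def)

lemma sym_Diff_edge: "sym T \<Longrightarrow> sym (T - edge x y)"
  by (auto simp: sym_def edge_def)

lemma rtrancl_symD: "sym R \<Longrightarrow> (x, y) \<in> R\<^sup>* \<Longrightarrow> (y, x) \<in> R\<^sup>*"
  by (meson symD sym_rtrancl)

lemma connected_on_finite: "connected_on V E \<Longrightarrow> finite E"
  unfolding connected_on_def by (meson finite_SigmaI finite_subset)

text \<open>Breadth-first search: with \<open>d\<close> the distance to \<open>r\<close> in
  \<open>E\<close>, \<open>p\<close> sends each vertex to its successor on a shortest walk to
  \<open>r\<close>.\<close>

lemma connected_on_rooted:
  assumes "connected_on V E" "r \<in> V"
  obtains p d where "rooted V r p d" "up V r p \<subseteq> E"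
proof -
  define d where "d x = (LEAST n. (x, r) \<in> E ^^ n)" for x
  have "\<exists>y. (x, y) \<in> E \<and> y \<in> V \<and> d y < d x" if x: "x \<in> V - {r}" for x
  proof -
    have "\<exists>n. (x, r) \<in> E ^^ n"
      using assms x by (metis DiffD1 connected_on_def rtrancl_imp_relpow)
    then have *: "(x, r) \<in> E ^^ d x"
      unfolding d_def by (rule LeastI_ex)
    then obtain m where m: "d x = Suc m"
      using x by (cases "d x") auto
    then obtain y where y: "(x, y) \<in> E" "(y, r) \<in> E ^^ m"
      using * by (metis relpow_Suc_D2)
    then have "d y \<le> m"
      unfolding d_def by (simp add: Least_le)
    then show ?thesis
      using y m assms by (auto simp: connected_on_def)
  qed
  then obtain p where "\<forall>x\<in>V - {r}. (x, p x) \<in> E \<and> p x \<in> V \<and> d (p x) < d x"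
    by metis
  then show thesis
    using assms by (intro that[of p d]) (auto simp: rooted_def up_def)
qed

lemma rooted_up_reaches_root:
  assumes "rooted V r p d" "x \<in> V"
  shows "(x, r) \<in> (up V r p)\<^sup>*"
  using assms(2)
proof (induction "d x" arbitrary: x rule: less_induct)
  case less
  show ?case
  proof (cases "x = r")
    case False
    with less assms have "(p x, r) \<in> (up V r p)\<^sup>*" "(x, p x) \<in> up V r p"
      by (auto simp: rooted_def up_def)
    then show ?thesis
      by (rule converse_rtrancl_into_rtrancl[rotated])
  qed simp
qed

lemma rooted_tree_on:
  assumes "finite V" "rooted V r p d"
  shows "tree_on V (up V r p \<union> (up V r p)\<inverse>)"
proof -
  let ?U = "up V r p"
  have U: "?U = (\<lambda>x. (x, p x)) ` (V - {r})"
    by (auto simp: up_def)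
  have r: "r \<in> V"
    using assms by (auto simp: rooted_def)
  \<comment> \<open>Two vertices cannot be parents of each other, since \<open>d\<close> decreases
    strictly along \<open>p\<close>; so no undirected edge is counted twice among the upward
    arcs.\<close>
  have inter: "?U \<inter> ?U\<inverse> = {}"
  proof -
    have False if "a \<in> V - {r}" "p a \<in> V - {r}" "p (p a) = a" for a
      using assms(2) that by (metis less_asym rooted_def)
    then show ?thesis
      unfolding up_def by fastforce
  qed
  have "card ?U = card V - 1"
    unfolding U using r assms(1) by (subst card_image) (auto simp: inj_on_def)
  moreover have "card (?U \<union> ?U\<inverse>) = card ?U + card (?U\<inverse>)"
    using inter assms(1) U by (intro card_Un_disjoint) auto
  ultimately have card: "card (?U \<union> ?U\<inverse>) = 2 * (card V - 1)"
    by simp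
  have irr: "irrefl (?U \<union> ?U\<inverse>)"
    using inter by (auto simp: irrefl_def)
  have sub: "?U \<union> ?U\<inverse> \<subseteq> V \<times> V"
    using assms(2) by (auto simp: rooted_def up_def)
  have sym: "sym (?U \<union> ?U\<inverse>)"
    by (auto simp: sym_def)
  have "(x, r) \<in> (?U \<union> ?U\<inverse>)\<^sup>*" if "x \<in> V" for x
    using rooted_up_reaches_root[OF assms(2) that] by (rule rtrancl_mono[THEN subsetD, rotated]) auto
  then have "(x, y) \<in> (?U \<union> ?U\<inverse>)\<^sup>*" if "x \<in> V" "y \<in> V" for x y
    using that sym by (meson rtrancl_symD rtrancl_trans)
  then show ?thesis
    using sym card assms irr sub r by (simp add: tree_on_def connected_on_def) blast
qed

lemma connected_on_spanning_tree:
  assumes "connected_on V E"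
  obtains T where "tree_on V T" "T \<subseteq> E"
proof -
  obtain r where "r \<in> V"
    using assms by (auto simp: connected_on_def)
  then obtain p d where pd: "rooted V r p d" "up V r p \<subseteq> E"
    using connected_on_rooted assms by metis
  have "(up V r p)\<inverse> \<subseteq> E"
    using pd(2) assms by (auto simp: connected_on_def sym_def)
  moreover have "tree_on V (up V r p \<union> (up V r p)\<inverse>)"
    using assms pd(1) by (intro rooted_tree_on) (auto simp: connected_on_def)
  ultimately show thesis
    using pd(2) that by blast
qed

lemma connected_on_card_ge:
  assumes "connected_on V E"
  shows "2 * (card V - 1) \<le> card E"
  using connected_on_spanning_tree[OF assms] connected_on_finite[OF assms]
  by (metis card_mono tree_on_def)

text \<open>A rooted tree inside \<open>T\<close> already has as many arcs as \<open>T\<close>, so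
  it exhausts \<open>T\<close>.\<close>

lemma tree_on_rooted:
  assumes "tree_on V T" "r \<in> V"
  obtains p d where "rooted V r p d" "T = up V r p \<union> (up V r p)\<inverse>"
proof -
  obtain p d where pd: "rooted V r p d" "up V r p \<subseteq> T"
    using assms connected_on_rooted unfolding tree_on_def by metis
  let ?S = "up V r p \<union> (up V r p)\<inverse>"
  have fin: "finite V" "finite T"
    using assms connected_on_finite by (auto simp: tree_on_def connected_on_def)
  have "?S \<subseteq> T"
    using pd(2) assms by (auto simp: tree_on_def connected_on_def sym_def)
  moreover have "card ?S = card T"
    using assms rooted_tree_on[OF fin(1) pd(1)] by (simp add: tree_on_def)
  ultimately have "?S = T"
    using fin by (simp add: card_subset_eq)
  then show thesis
    using pd that by metis
qed

section \<open>Bridges and edge exchange\<close>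

text \<open>Follow the walk from \<open>a\<close> up to its first use of the edge: at that moment it
  stands at \<open>x\<close> or at \<open>y\<close>.\<close>

lemma reaches_endpoint_Diff_edge:
  assumes "(a, y) \<in> T\<^sup>*"
  shows "(a, x) \<in> (T - edge x y)\<^sup>* \<or> (a, y) \<in> (T - edge x y)\<^sup>*"
  using assms
proof (induction rule: converse_rtrancl_induct)
  case (step a b)
  show ?case
  proof (cases "(a, b) \<in> edge x y")
    case False
    with step show ?thesis
      by (meson DiffI converse_rtrancl_into_rtrancl)
  qed (auto simp: in_edge_iff)
qed simp

text \<open>If the endpoints stayed connected, the rest would still connect all of \<open>V\<close>,
  with fewer arcs than a spanning tree has.\<close>

lemma tree_on_bridge:
  assumes T: "tree_on V T" and xy: "(x, y) \<in> T"
  shows "(x, y) \<notin> (T - edge x y)\<^sup>*"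
proof
  assume *: "(x, y) \<in> (T - edge x y)\<^sup>*"
  have C: "connected_on V T" and sT: "sym T"
    using T by (auto simp: tree_on_def connected_on_def)
  have "(a, y) \<in> (T - edge x y)\<^sup>*" if "a \<in> V" for a
    using reaches_endpoint_Diff_edge[of a y T x] C that xy *
    by (auto simp: connected_on_def intro: rtrancl_trans)
  then have "\<forall>a\<in>V. \<forall>b\<in>V. (a, b) \<in> (T - edge x y)\<^sup>*"
    by (meson rtrancl_symD rtrancl_trans sT sym_Diff_edge)
  then have "connected_on V (T - edge x y)"
    using C by (auto simp: connected_on_def irrefl_def sym_Diff_edge)
  then have "card T \<le> card (T - edge x y)"
    using connected_on_card_ge T by (metis tree_on_def)
  moreover have "T - edge x y \<subset> T"
    using xy by (auto simp: edge_def)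
  ultimately show False
    using psubset_card_mono[OF connected_on_finite[OF C], of "T - edge x y"] by simp
qed

text \<open>Deleting the bridge \<open>zw\<close> leaves two sides, \<open>v\<close> on that of
  \<open>z\<close> and \<open>u\<close> on that of \<open>w\<close>; the edge \<open>uv\<close>
  crosses between them and joins them again.\<close>

lemma tree_on_exchange:
  assumes T: "tree_on V T" and zw: "(z, w) \<in> T"
    and vz: "(v, z) \<in> (T - edge z w)\<^sup>*" and uw: "(u, w) \<in> (T - edge z w)\<^sup>*"
  shows "u \<noteq> v" "(u, v) \<notin> T - edge z w" "tree_on V (T - edge z w \<union> edge u v)"
proof -
  let ?R = "T - edge z w"
  have C: "connected_on V T" and sT: "sym T" and TV: "T \<subseteq> V \<times> V" and irT: "irrefl T"
    using T by (auto simp: tree_on_def connected_on_def)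
  have sR: "sym ?R"
    using sT by (rule sym_Diff_edge)
  have br: "(z, w) \<notin> ?R\<^sup>*"
    using tree_on_bridge[OF T zw] .
  show uv: "u \<noteq> v"
    using br vz uw sR by (meson rtrancl_symD rtrancl_trans)
  show new: "(u, v) \<notin> ?R"
    using br vz uw sR by (meson r_into_rtrancl rtrancl_symD rtrancl_trans)
  let ?T' = "?R \<union> edge u v"
  have sT': "sym ?T'"
    using sR sym_edge by (metis sym_Un)
  have RV: "a \<in> V" if "(a, b) \<in> ?R\<^sup>*" "b \<in> V" for a b
    using that TV by (induction rule: converse_rtrancl_induct) auto
  have uvV: "u \<in> V" "v \<in> V"
    using RV vz uw zw TV by auto
  have mono: "?R\<^sup>* \<subseteq> ?T'\<^sup>*"
    by (rule rtrancl_mono) auto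
  have "(u, v) \<in> ?T'\<^sup>*"
    by (auto simp: edge_def)
  then have zw': "(z, w) \<in> ?T'\<^sup>*"
    using mono vz uw sT' by (meson rtrancl_symD rtrancl_trans subsetD)
  have "(a, w) \<in> ?T'\<^sup>*" if "a \<in> V" for a
  proof -
    have "(a, w) \<in> T\<^sup>*"
      using C zw that by (auto simp: connected_on_def)
    then have "(a, z) \<in> ?T'\<^sup>* \<or> (a, w) \<in> ?T'\<^sup>*"
      using reaches_endpoint_Diff_edge[of a w T z] mono by blast
    then show ?thesis
      using zw' by (auto intro: rtrancl_trans)
  qed
  then have "\<forall>a\<in>V. \<forall>b\<in>V. (a, b) \<in> ?T'\<^sup>*"
    using sT' by (meson rtrancl_symD rtrancl_trans)
  then have conn: "connected_on V ?T'"
    using C sT' uv uvV TV irT by (auto simp: connected_on_def irrefl_def edge_def)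
  have fin: "finite T"
    using C by (rule connected_on_finite)
  have "z \<noteq> w"
    using irT zw by (auto simp: irrefl_def)
  then have ce: "card (edge z w) = 2" "card (edge u v) = 2"
    using uv by (auto simp: edge_def)
  have sub: "edge z w \<subseteq> T"
    using zw sT by (auto simp: edge_def sym_def)
  have "(v, u) \<notin> ?R"
    using new sR by (meson symD)
  then have "?R \<inter> edge u v = {}"
    using new by (auto simp: edge_def)
  then have "card ?T' = card ?R + 2"
    using fin ce by (subst card_Un_disjoint) (auto simp: edge_def)
  also have "card ?R = card T - 2"
    using sub ce by (subst card_Diff_subset) (auto simp: edge_def)
  also have "card T - 2 + 2 = card T"
    using card_mono[OF fin sub] ce by simp
  finally show "tree_on V ?T'"
    using T conn by (simp add: tree_on_def)
qed

section \<open>Degrees, leaves and branch vertices\<close>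

definition nbr_deg :: "'a rel \<Rightarrow> 'a \<Rightarrow> nat" where
  "nbr_deg T x = card (T `` {x})"

text \<open>The balance form avoids subtraction on naturals and stays correct when an old and a new
  endpoint coincide, as happens when a whole edge end is kept.\<close>

lemma exchange_nbr_deg:
  assumes "finite T" "sym T" "(z, w) \<in> T" "z \<noteq> w" "u \<noteq> v" "(u, v) \<notin> T - edge z w"
  shows "nbr_deg (T - edge z w \<union> edge u v) a + of_bool (a = z \<or> a = w) =
         nbr_deg T a + of_bool (a = u \<or> a = v)"
proof -
  let ?R = "T - edge z w"
  have fin: "finite (T `` {a})"
    using assms(1) by (rule finite_Image)
  have "card (?R `` {a}) + of_bool (a = z \<or> a = w) = card (T `` {a})"
  proof (cases "a = z \<or> a = w")
    case True
    then obtain b where b: "b \<in> T `` {a}" "?R `` {a} = T `` {a} - {b}"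
      using assms(2-4) by (auto simp: edge_def sym_def)
    then show ?thesis
      using True fin card_Suc_Diff1 by fastforce
  next
    case False
    then have "?R `` {a} = T `` {a}"
      by (auto simp: edge_def)
    with False show ?thesis by simp
  qed
  moreover have "card ((?R \<union> edge u v) `` {a}) = card (?R `` {a}) + of_bool (a = u \<or> a = v)"
  proof (cases "a = u \<or> a = v")
    case True
    have "(v, u) \<notin> ?R"
      using assms(2,6) by (auto simp: sym_def edge_def)
    then obtain b where b: "b \<notin> ?R `` {a}" "(?R \<union> edge u v) `` {a} = insert b (?R `` {a})"
      using True assms(5,6) by (auto simp: edge_def)
    have "finite (?R `` {a})"
      using assms(1) by (simp add: finite_Image)
    with b True show ?thesis by simp
  next
    case False
    then have "(?R \<union> edge u v) `` {a} = ?R `` {a}"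
      by (auto simp: edge_def)
    with False show ?thesis by simp
  qed
  ultimately show ?thesis
    by (simp add: nbr_deg_def)
qed

definition leaves :: "'a set \<Rightarrow> 'a rel \<Rightarrow> 'a set" where
  "leaves V T = {x \<in> V. nbr_deg T x = 1}"

definition branches :: "'a set \<Rightarrow> 'a rel \<Rightarrow> 'a set" where
  "branches V T = {x \<in> V. 3 \<le> nbr_deg T x}"

lemma sum_nbr_deg:
  assumes "finite V" "T \<subseteq> V \<times> V"
  shows "(\<Sum>x\<in>V. nbr_deg T x) = card T"
proof -
  have "T = (SIGMA x:V. T `` {x})"
    using assms(2) by auto
  moreover have "card (SIGMA x:V. T `` {x}) = (\<Sum>x\<in>V. card (T `` {x}))"
    using assms by (intro card_SigmaI) (auto intro: finite_subset[of _ V])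
  ultimately show ?thesis
    by (simp add: nbr_deg_def)
qed

lemma nbr_deg_pos:
  assumes "connected_on V T" "x \<in> V" "y \<in> V" "x \<noteq> y"
  shows "0 < nbr_deg T x"
proof -
  have "(x, y) \<in> T\<^sup>*"
    using assms by (auto simp: connected_on_def)
  with assms(4) obtain b where "(x, b) \<in> T"
    by (meson converse_rtranclE)
  moreover have "finite (T `` {x})"
    using connected_on_finite[OF assms(1)] by (rule finite_Image)
  ultimately show ?thesis
    unfolding nbr_deg_def by (subst card_gt_0_iff) auto
qed

text \<open>The numbers degree minus 2 add up to -2 over a tree. Leaves contribute -1, branch
  vertices at least 1, and all other vertices 0.\<close>

lemma card_leaves_ge:
  assumes T: "tree_on V T" and V2: "2 \<le> card V"
  shows "card (branches V T) + 2 \<le> card (leaves V T)"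
proof -
  let ?L = "leaves V T" and ?B = "branches V T"
  have C: "connected_on V T" and fin: "finite V" and TV: "T \<subseteq> V \<times> V"
    using T by (auto simp: tree_on_def connected_on_def)
  have pos: "0 < nbr_deg T x" if x: "x \<in> V" for x
  proof -
    have "V \<noteq> {x}"
      using V2 by auto
    then obtain y where "y \<in> V" "x \<noteq> y"
      using x by blast
    then show ?thesis
      using nbr_deg_pos[OF C x] by simp
  qed
  have "2 + (of_bool (x \<in> ?B)::int) - of_bool (x \<in> ?L) \<le> int (nbr_deg T x)" if "x \<in> V" for x
    using pos[OF that] that by (auto simp: leaves_def branches_def)
  then have "(\<Sum>x\<in>V. 2 + (of_bool (x \<in> ?B)::int) - of_bool (x \<in> ?L)) \<le> (\<Sum>x\<in>V. int (nbr_deg T x))"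
    by (rule sum_mono)
  also have "(\<Sum>x\<in>V. int (nbr_deg T x)) = int (card T)"
    using sum_nbr_deg[OF fin TV] by (metis of_nat_sum)
  also have "\<dots> = 2 * int (card V) - 2"
    using T V2 by (simp add: tree_on_def)
  finally have "2 * int (card V) + (\<Sum>x\<in>V. (of_bool (x \<in> ?B)::int)) - (\<Sum>x\<in>V. of_bool (x \<in> ?L)) \<le> 2 * int (card V) - 2"
    by (simp add: sum.distrib sum_subtractf)
  moreover have "(\<Sum>x\<in>V. (of_bool (x \<in> ?B)::int)) = int (card ?B)"
    using fin by (simp add: branches_def Int_def)
  moreover have "(\<Sum>x\<in>V. (of_bool (x \<in> ?L)::int)) = int (card ?L)"
    using fin by (simp add: leaves_def Int_def)
  ultimately show ?thesis by linarith
qed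

lemma tree_on_props:
  assumes "tree_on V T"
  shows "finite V" "finite T" "T \<subseteq> V \<times> V" "sym T" "irrefl T"
  using assms connected_on_finite by (auto simp: tree_on_def connected_on_def)

lemma finite_branches: "tree_on V T \<Longrightarrow> finite (branches V T)"
  by (simp add: branches_def tree_on_props(1))

lemma finite_leaves: "tree_on V T \<Longrightarrow> finite (leaves V T)"
  by (simp add: leaves_def tree_on_props(1))

section \<open>Rooted trees\<close>

text \<open>Below, \<open>(x, y) \<in> U\<^sup>*\<close> reads: \<open>y\<close> is \<open>x\<close>
  or an ancestor of \<open>x\<close>. The vertices \<open>x\<close> with
  \<open>(x, z) \<in> U\<^sup>*\<close> thus form the subtree at \<open>z\<close>.\<close>

locale rooted_tree =
  fixes V :: "'a set" and T :: "'a rel" and r :: 'a and p :: "'a \<Rightarrow> 'a" and d :: "'a \<Rightarrow> nat"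
  assumes tree: "tree_on V T"
    and rooted: "rooted V r p d"
    and arcs: "T = up V r p \<union> (up V r p)\<inverse>"
begin

abbreviation U :: "'a rel" where "U \<equiv> up V r p"

lemma parent: "x \<in> V \<Longrightarrow> x \<noteq> r \<Longrightarrow> p x \<in> V \<and> d (p x) < d x"
  using rooted by (simp add: rooted_def)

lemma parent_neq: "x \<in> V \<Longrightarrow> x \<noteq> r \<Longrightarrow> p x \<noteq> x"
  using parent by (metis less_irrefl)

lemma in_U_iff: "(x, y) \<in> U \<longleftrightarrow> x \<in> V \<and> x \<noteq> r \<and> y = p x"
  by (auto simp: up_def)

lemma in_T_iff: "(x, y) \<in> T \<longleftrightarrow> (x, y) \<in> U \<or> (y, x) \<in> U"
  by (auto simp: arcs)

lemma U_depth: "(x, y) \<in> U\<^sup>* \<Longrightarrow> d y \<le> d x"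
  by (induction rule: rtrancl_induct) (auto simp: in_U_iff dest: parent)

lemma U_in: "(x, y) \<in> U\<^sup>* \<Longrightarrow> x \<in> V \<Longrightarrow> y \<in> V"
  by (induction rule: rtrancl_induct) (auto simp: in_U_iff dest: parent)

lemma root_U: "(r, y) \<in> U\<^sup>* \<Longrightarrow> y = r"
  by (erule converse_rtranclE) (auto simp: in_U_iff)

lemma root_U': "x \<in> V \<Longrightarrow> (x, r) \<in> U\<^sup>*"
  using rooted_up_reaches_root[OF rooted] .

lemma U_linear:
  "(x, y) \<in> U\<^sup>* \<Longrightarrow> (x, z) \<in> U\<^sup>* \<Longrightarrow> (y, z) \<in> U\<^sup>* \<or> (z, y) \<in> U\<^sup>*"
  by (rule single_valued_confluent) (auto simp: single_valued_def in_U_iff)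

text \<open>This and \<open>not_below_connected_root\<close> identify the two sides of the edge from
  \<open>z\<close> to its parent: the subtree at \<open>z\<close>, and everything else, which
  contains the root.\<close>

lemma below_connected:
  assumes "(x, z) \<in> U\<^sup>*" "z \<in> V" "z \<noteq> r"
  shows "(x, z) \<in> (T - edge z (p z))\<^sup>*"
  using assms(1)
proof (induction rule: converse_rtrancl_induct)
  case (step a b)
  \<comment> \<open>The lower end of every arc on the way up to \<open>z\<close> lies strictly
    deeper than \<open>z\<close>, so the arc is not the deleted one.\<close>
  have "d z < d a" "d (p z) < d z"
    using step parent assms U_depth[of b z] by (auto simp: in_U_iff dest: parent)
  then have "(a, b) \<in> T - edge z (p z)"
    using step by (auto simp: in_T_iff in_edge_iff)
  then show ?case
    using step by (auto intro: converse_rtrancl_into_rtrancl)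
qed simp

lemma not_below_connected_root:
  assumes "a \<in> V" "(a, z) \<notin> U\<^sup>*"
  shows "(a, r) \<in> (T - edge z (p z))\<^sup>*"
  using root_U'[OF assms(1)] assms(2)
proof (induction rule: converse_rtrancl_induct)
  case (step a b)
  then have "(b, z) \<notin> U\<^sup>*" "a \<noteq> z"
    by (auto intro: converse_rtrancl_into_rtrancl)
  moreover have "(a, b) \<in> T - edge z (p z)"
    using step calculation by (auto simp: in_T_iff in_edge_iff)
  ultimately show ?case
    using step by (auto intro: converse_rtrancl_into_rtrancl)
qed simp

lemma parent_not_below: "z \<in> V \<Longrightarrow> z \<noteq> r \<Longrightarrow> (p z, z) \<notin> U\<^sup>*"
  using U_depth parent by (meson not_le)

text \<open>The form of exchange used from here on: the subtree at \<open>z\<close> is cut off and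
  hung, by its vertex \<open>v\<close>, on a vertex \<open>a\<close> outside it.\<close>

lemma exchange:
  assumes z: "z \<in> V" "z \<noteq> r" and v: "(v, z) \<in> U\<^sup>*" and a: "a \<in> V" "(a, z) \<notin> U\<^sup>*"
  shows "tree_on V (T - edge z (p z) \<union> edge a v)"
    and "nbr_deg (T - edge z (p z) \<union> edge a v) c + of_bool (c = z \<or> c = p z) =
         nbr_deg T c + of_bool (c = a \<or> c = v)"
proof -
  note props = tree_on_props[OF tree]
  have sR: "sym (T - edge z (p z))"
    using props by (simp add: sym_Diff_edge)
  have zp: "(z, p z) \<in> T" "z \<noteq> p z"
    using z parent_neq[of z] by (auto simp: in_T_iff in_U_iff)
  have "(p z, r) \<in> (T - edge z (p z))\<^sup>*"
    using not_below_connected_root parent_not_below z parent by simp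
  then have ap: "(a, p z) \<in> (T - edge z (p z))\<^sup>*"
    using not_below_connected_root[OF a] sR by (meson rtrancl_symD rtrancl_trans)
  have vz: "(v, z) \<in> (T - edge z (p z))\<^sup>*"
    using below_connected v z by simp
  note ex = tree_on_exchange[OF tree zp(1) vz ap]
  show "tree_on V (T - edge z (p z) \<union> edge a v)"
    by (rule ex(3))
  show "nbr_deg (T - edge z (p z) \<union> edge a v) c + of_bool (c = z \<or> c = p z) =
         nbr_deg T c + of_bool (c = a \<or> c = v)"
    using props zp ex by (intro exchange_nbr_deg) auto
qed

lemma nbrs_root: "T `` {r} = {y \<in> V. y \<noteq> r \<and> p y = r}"
  by (auto simp: arcs up_def)

lemma nbrs: "x \<in> V \<Longrightarrow> x \<noteq> r \<Longrightarrow> T `` {x} = insert (p x) {y \<in> V. y \<noteq> r \<and> p y = x}"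
  by (auto simp: arcs up_def)

lemma finite_nbrs: "finite (T `` {x})"
  using tree_on_props(2)[OF tree] by (rule finite_Image)

lemma leaf_root_child_unique:
  assumes "r \<in> leaves V T" "x \<in> V" "x \<noteq> r" "p x = r" "y \<in> V" "y \<noteq> r" "p y = r"
  shows "x = y"
proof -
  have "card (T `` {r}) = 1"
    using assms(1) by (simp add: leaves_def nbr_deg_def)
  then obtain q where "T `` {r} = {q}"
    by (rule card_1_singletonE)
  moreover have "x \<in> T `` {r}" "y \<in> T `` {r}"
    using assms unfolding nbrs_root by auto
  ultimately show ?thesis
    by simp
qed

lemma nbr_deg_ge_children:
  assumes "a \<in> V" "a \<noteq> r" "C \<subseteq> {y \<in> V. y \<noteq> r \<and> p y = a}"
  shows "Suc (card C) \<le> nbr_deg T a"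
proof -
  have "p a \<notin> C"
  proof
    assume "p a \<in> C"
    then have "d (p (p a)) < d (p a)" "p (p a) = a"
      using assms(3) parent by auto
    then show False
      using parent[OF assms(1,2)] by simp
  qed
  moreover have "finite C"
    using assms(3) tree_on_props(1)[OF tree] by (auto intro: finite_subset)
  ultimately have "Suc (card C) = card (insert (p a) C)"
    by simp
  also have "\<dots> \<le> card (T `` {a})"
    using assms(3) nbrs[OF assms(1,2)] by (intro card_mono finite_nbrs) auto
  finally show ?thesis
    by (simp add: nbr_deg_def)
qed

lemma child_unique:
  assumes "nbr_deg T a \<le> 2" "a \<in> V" "a \<noteq> r" "x \<in> V" "x \<noteq> r" "p x = a" "y \<in> V" "y \<noteq> r" "p y = a"
  shows "x = y"
proof (rule ccontr)
  assume "x \<noteq> y"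
  then have "Suc (card {x, y}) = 3"
    by simp
  moreover have "Suc (card {x, y}) \<le> nbr_deg T a"
    using assms by (intro nbr_deg_ge_children) auto
  ultimately show False
    using assms(1) by simp
qed

lemma leaf_no_child:
  assumes "v \<in> leaves V T" "v \<noteq> r" "x \<in> V" "x \<noteq> r"
  shows "p x \<noteq> v"
  using nbr_deg_ge_children[of v "{x}"] assms by (auto simp: leaves_def)

text \<open>Without a branch vertex among them, \<open>v\<close> and its ancestors would form a set
  closed under adjacency in \<open>T\<close>, hence all of \<open>V\<close>, leaving no room for a
  branch vertex.\<close>

lemma branch_above_leaf:
  assumes r: "r \<in> leaves V T" and v: "v \<in> leaves V T" "v \<noteq> r" and B: "branches V T \<noteq> {}"
  obtains w where "w \<in> branches V T" "(v, w) \<in> U\<^sup>*"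
proof (rule ccontr)
  assume "\<not> thesis"
  with that have no: "w \<notin> branches V T" if "(v, w) \<in> U\<^sup>*" for w
    using \<open>(v, w) \<in> U\<^sup>*\<close> by blast
  have vV: "v \<in> V"
    using v by (simp add: leaves_def)
  \<comment> \<open>An ancestor \<open>a\<close> of degree at most 2 has just one child, the one
    through which the path from \<open>v\<close> arrives. At the root this holds because the root is
    a leaf.\<close>
  have closed: "(v, b) \<in> U\<^sup>*" if va: "(v, a) \<in> U\<^sup>*" and ab: "(a, b) \<in> T" for a b
  proof (cases "(a, b) \<in> U")
    case True
    with va show ?thesis by simp
  next
    case False
    with ab have b: "b \<in> V" "b \<noteq> r" "p b = a"
      by (auto simp: in_T_iff in_U_iff)
    with leaf_no_child v have "v \<noteq> a"
      by blast
    with va obtain c where vc: "(v, c) \<in> U\<^sup>*" and "(c, a) \<in> U"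
      by (meson rtranclE)
    then have c: "c \<in> V" "c \<noteq> r" "p c = a"
      by (auto simp: in_U_iff)
    have aV: "a \<in> V"
      using U_in va vV by blast
    then have "nbr_deg T a \<le> 2"
      using no[OF va] by (simp add: branches_def)
    then have "b = c"
      using aV b c r child_unique leaf_root_child_unique by (cases "a = r") blast+
    with vc show ?thesis by simp
  qed
  obtain w where w: "w \<in> branches V T"
    using B by blast
  then have "(v, w) \<in> T\<^sup>*"
    using vV tree by (auto simp: branches_def tree_on_def connected_on_def)
  then have "(v, w) \<in> U\<^sup>*"
    by (induction rule: rtrancl_induct) (auto intro: closed)
  with no w show False by blast
qed

end

lemma tree_on_rooted_tree:
  assumes "tree_on V T" "r \<in> V"
  obtains p d where "rooted_tree V T r p d"
  using tree_on_rooted[OF assms] assms(1) by (metis rooted_tree.intro)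

section \<open>Optimal spanning trees\<close>

definition optimal :: "'a set \<Rightarrow> 'a rel \<Rightarrow> 'a rel \<Rightarrow> bool" where
  "optimal V E T \<longleftrightarrow> tree_on V T \<and> T \<subseteq> E \<and>
     (\<forall>S. tree_on V S \<longrightarrow> S \<subseteq> E \<longrightarrow> card (branches V T) \<le> card (branches V S) \<and>
       (card (branches V S) = card (branches V T) \<longrightarrow> card (leaves V T) \<le> card (leaves V S)))"

text \<open>Since the number of branch vertices is already minimal, an inclusion of branch sets is
  an equality, which makes the comparison of leaves available.\<close>

lemma optimal_exchange:
  assumes "optimal V E T" "tree_on V S" "S \<subseteq> E" "branches V S \<subseteq> branches V T"
  shows "branches V S = branches V T" "card (leaves V T) \<le> card (leaves V S)"
proof -
  have fin: "finite (branches V T)"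
    using assms(1) finite_branches by (auto simp: optimal_def)
  then have "card (branches V S) = card (branches V T)"
    using assms card_mono[OF fin assms(4)] by (auto simp: optimal_def intro: antisym)
  then show "branches V S = branches V T" "card (leaves V T) \<le> card (leaves V S)"
    using assms fin by (auto simp: optimal_def card_subset_eq)
qed

lemma optimal_transfer:
  assumes "optimal V E T" "tree_on V S" "S \<subseteq> E" "branches V S \<subseteq> branches V T"
    "card (leaves V S) \<le> card (leaves V T)"
  shows "optimal V E S"
  using assms optimal_exchange[OF assms(1-4)] by (simp add: optimal_def)

text \<open>The edge \<open>uv\<close> would close a cycle through a branch vertex \<open>w\<close>.
  Dropping a cycle edge \<open>zw\<close> creates no branch vertex and leaves \<open>w\<close> with
  degree at least 2, while the number of leaves falls.\<close>

lemma optimal_leaves_nonadjacent: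
  assumes opt: "optimal V E T" and symE: "sym E" and B: "branches V T \<noteq> {}"
    and u: "u \<in> leaves V T" and v: "v \<in> leaves V T" and uv: "u \<noteq> v"
  shows "(u, v) \<notin> E"
proof
  assume uvE: "(u, v) \<in> E"
  have T: "tree_on V T" "T \<subseteq> E"
    using opt by (auto simp: optimal_def)
  have uV: "u \<in> V" "v \<in> V"
    using u v by (auto simp: leaves_def)
  obtain p d where "rooted_tree V T u p d"
    using tree_on_rooted_tree T uV by metis
  then interpret rooted_tree V T u p d .
  obtain w where w: "w \<in> branches V T" "(v, w) \<in> U\<^sup>*"
    using branch_above_leaf u v uv B by metis
  have uw: "u \<noteq> w" "v \<noteq> w"
    using w(1) u v by (auto simp: leaves_def branches_def)
  with w(2) obtain z where vz: "(v, z) \<in> U\<^sup>*" and "(z, w) \<in> U"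
    by (metis rtranclE)
  then have z: "z \<in> V" "z \<noteq> u" "w = p z"
    by (auto simp: in_U_iff)
  have uz: "(u, z) \<notin> U\<^sup>*"
    using root_U z by blast
  let ?S = "T - edge z (p z) \<union> edge u v"
  have S: "tree_on V ?S"
    using exchange(1)[OF z(1,2) vz uV(1) uz] .
  have deg: "nbr_deg ?S c + of_bool (c = z \<or> c = w) = nbr_deg T c + of_bool (c = u \<or> c = v)" for c
    using exchange(2)[OF z(1,2) vz uV(1) uz] z(3) by simp
  have SE: "?S \<subseteq> E"
    using T uvE symE by (auto simp: edge_def sym_def)
  have deg1: "nbr_deg T u = 1" "nbr_deg T v = 1" "3 \<le> nbr_deg T w"
    using u v w by (auto simp: leaves_def branches_def)
  have BS: "branches V ?S \<subseteq> branches V T"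
  proof
    fix c assume "c \<in> branches V ?S"
    then show "c \<in> branches V T"
      using deg[of c] deg1 by (auto simp: branches_def of_bool_def split: if_splits)
  qed
  \<comment> \<open>Only \<open>z\<close> loses degree without being a branch vertex. The case
    \<open>z = v\<close> is included: \<open>v\<close> then remains a leaf.\<close>
  have LS: "leaves V ?S \<subseteq> insert z (leaves V T - {u, v})"
  proof
    fix c assume "c \<in> leaves V ?S"
    then show "c \<in> insert z (leaves V T - {u, v})"
      using deg[of c] deg1 z uw by (auto simp: leaves_def of_bool_def split: if_splits)
  qed
  have fin: "finite (leaves V T)"
    using T finite_leaves by blast
  have "card (leaves V ?S) \<le> card (insert z (leaves V T - {u, v}))"
    using fin LS by (intro card_mono) auto
  also have "\<dots> \<le> Suc (card (leaves V T - {u, v}))"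
    using fin by (simp add: card_insert_if)
  also have "card (leaves V T - {u, v}) = card (leaves V T) - 2"
    using u v uv fin by (subst card_Diff_subset) auto
  finally have "card (leaves V ?S) \<le> Suc (card (leaves V T) - 2)" .
  moreover have "2 \<le> card (leaves V T)"
    using card_mono[OF fin, of "{u, v}"] u v uv by simp
  ultimately show False
    using optimal_exchange(2)[OF opt S SE BS] by linarith
qed

text \<open>Moving \<open>x\<close> from its parent to \<open>u\<close> changes only the degrees of
  \<open>u\<close> and \<open>p x\<close>. The leaf \<open>u\<close> is lost, so optimality forces
  \<open>p x\<close> to become a leaf in exchange, which means that it had degree 2.\<close>

lemma optimal_parent_of_nbr:
  assumes opt: "optimal V E T" and E: "sym E" "irrefl E" "E \<subseteq> V \<times> V"
    and rt: "rooted_tree V T u p d" and u: "u \<in> leaves V T"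
    and x: "(u, x) \<in> E" and px: "p x \<noteq> u"
  shows "nbr_deg T (p x) = 2"
    and "\<exists>S. optimal V E S \<and> branches V S = branches V T \<and> leaves V S = insert (p x) (leaves V T - {u})"
proof -
  interpret rooted_tree V T u p d by (rule rt)
  have T: "tree_on V T" "T \<subseteq> E"
    using opt by (auto simp: optimal_def)
  have xV: "x \<in> V" "x \<noteq> u" and uV: "u \<in> V"
    using x E by (auto simp: irrefl_def)
  have pxV: "p x \<in> V" "p x \<noteq> x"
    using parent parent_neq xV by auto
  have ux: "(u, x) \<notin> U\<^sup>*"
    using root_U xV by blast
  let ?S = "T - edge x (p x) \<union> edge u x"
  have S: "tree_on V ?S"
    using exchange(1)[OF xV rtrancl.rtrancl_refl uV ux] .
  have deg: "nbr_deg ?S c + of_bool (c = x \<or> c = p x) = nbr_deg T c + of_bool (c = u \<or> c = x)" for c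
    using exchange(2)[OF xV rtrancl.rtrancl_refl uV ux] .
  have SE: "?S \<subseteq> E"
    using T x E by (auto simp: edge_def sym_def)
  \<comment> \<open>As \<open>p x\<close> is not the root, it has a parent besides its child
    \<open>x\<close>.\<close>
  have deg1: "nbr_deg T u = 1" "2 \<le> nbr_deg T (p x)"
    using u nbr_deg_ge_children[of "p x" "{x}"] xV px pxV by (auto simp: leaves_def)
  have BS: "branches V ?S \<subseteq> branches V T"
  proof
    fix c assume "c \<in> branches V ?S"
    then show "c \<in> branches V T"
      using deg[of c] deg1 by (auto simp: branches_def of_bool_def split: if_splits)
  qed
  have fin: "finite (leaves V T)"
    using T finite_leaves by blast
  show deg2: "nbr_deg T (p x) = 2"
  proof (rule ccontr)
    assume "nbr_deg T (p x) \<noteq> 2"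
    then have deg3: "3 \<le> nbr_deg T (p x)"
      using deg1 by simp
    have "leaves V ?S \<subseteq> leaves V T - {u}"
    proof
      fix c assume "c \<in> leaves V ?S"
      then show "c \<in> leaves V T - {u}"
        using deg[of c] deg1 deg3 px xV by (auto simp: leaves_def of_bool_def split: if_splits)
    qed
    then have "leaves V ?S \<subset> leaves V T"
      using u by blast
    then have "card (leaves V ?S) < card (leaves V T)"
      using fin by (rule psubset_card_mono[rotated])
    then show False
      using optimal_exchange(2)[OF opt S SE BS] by simp
  qed
  have LS: "leaves V ?S = insert (p x) (leaves V T - {u})"
  proof (rule set_eqI)
    fix c
    show "c \<in> leaves V ?S \<longleftrightarrow> c \<in> insert (p x) (leaves V T - {u})"
      using deg[of c] deg1 deg2 px xV pxV by (auto simp: leaves_def of_bool_def split: if_splits)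
  qed
  have "card (insert (p x) (leaves V T - {u})) \<le> Suc (card (leaves V T - {u}))"
    using fin by (simp add: card_insert_if)
  also have "\<dots> = card (leaves V T)"
    using fin u by (rule card_Suc_Diff1)
  finally have "card (leaves V ?S) \<le> card (leaves V T)"
    unfolding LS .
  then have "optimal V E ?S"
    using optimal_transfer[OF opt S SE BS] by blast
  then show "\<exists>S. optimal V E S \<and> branches V S = branches V T \<and> leaves V S = insert (p x) (leaves V T - {u})"
    using LS optimal_exchange(1)[OF opt S SE BS] by blast
qed

section \<open>End branches\<close>

definition delete_vertex :: "'a rel \<Rightarrow> 'a \<Rightarrow> 'a rel" where
  "delete_vertex T w = {(a, b) \<in> T. a \<noteq> w \<and> b \<noteq> w}"

definition end_branch :: "'a set \<Rightarrow> 'a rel \<Rightarrow> 'a \<Rightarrow> bool" where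
  "end_branch V T w \<longleftrightarrow> w \<in> branches V T \<and>
     (\<forall>x\<in>branches V T - {w}. \<forall>y\<in>branches V T - {w}. (x, y) \<in> (delete_vertex T w)\<^sup>*)"

lemma sym_delete_vertex: "sym T \<Longrightarrow> sym (delete_vertex T w)"
  by (auto simp: delete_vertex_def sym_def)

text \<open>A branch vertex \<open>w\<close> with the largest value of \<open>d\<close> has no other
  branch vertex below it, so all the others are joined through the root.\<close>

lemma end_branch_exists:
  assumes T: "tree_on V T" and B: "branches V T \<noteq> {}"
  obtains w where "end_branch V T w"
proof -
  obtain r where r: "r \<in> V"
    using B by (auto simp: branches_def)
  obtain p d where "rooted_tree V T r p d"
    using tree_on_rooted_tree T r by metis
  then interpret rooted_tree V T r p d .
  have fin: "finite (branches V T)"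
    using finite_branches T .
  obtain w where w: "w \<in> branches V T" and "d w = Max (d ` branches V T)"
    using Max_in[of "d ` branches V T"] fin B
    by (metis (mono_tags, lifting) finite_imageI imageE image_is_empty)
  then have max: "d x \<le> d w" if "x \<in> branches V T" for x
    using fin that by simp
  have not_above: "(x, w) \<notin> U\<^sup>*" if x: "x \<in> branches V T - {w}" for x
  proof
    assume "(x, w) \<in> U\<^sup>*"
    with x obtain y where "(x, y) \<in> U" "(y, w) \<in> U\<^sup>*"
      by (metis DiffD2 converse_rtranclE singletonI)
    then have "d w < d x"
      using U_depth parent by (metis in_U_iff le_less_trans)
    then show False
      using max[of x] x by simp
  qed
  \<comment> \<open>The upward path of a vertex that is not below \<open>w\<close> never meets
    \<open>w\<close>.\<close>
  have to_root: "(x, r) \<in> (delete_vertex T w)\<^sup>*" if "x \<in> V" "(x, w) \<notin> U\<^sup>*" for x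
    using root_U'[OF that(1)] that(2)
  proof (induction rule: converse_rtrancl_induct)
    case (step a b)
    then have "a \<noteq> w" "(b, w) \<notin> U\<^sup>*"
      by (auto intro: converse_rtrancl_into_rtrancl)
    moreover from this have "(a, b) \<in> delete_vertex T w"
      using step by (auto simp: delete_vertex_def in_T_iff)
    ultimately show ?case
      using step by (auto intro: converse_rtrancl_into_rtrancl)
  qed simp
  have sy: "sym (delete_vertex T w)"
    by (rule sym_delete_vertex[OF tree_on_props(4)[OF T]])
  have "(x, y) \<in> (delete_vertex T w)\<^sup>*" if "x \<in> branches V T - {w}" "y \<in> branches V T - {w}" for x y
  proof -
    have "x \<in> V" "y \<in> V"
      using that by (auto simp: branches_def)
    then have "(x, r) \<in> (delete_vertex T w)\<^sup>*" "(y, r) \<in> (delete_vertex T w)\<^sup>*"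
      using that to_root not_above by simp_all
    then show ?thesis
      using sy by (meson rtrancl_symD rtrancl_trans)
  qed
  then have "end_branch V T w"
    using w by (simp add: end_branch_def)
  then show thesis
    by (rule that)
qed

text \<open>With the root at \<open>w\<close>, the components of \<open>T\<close> minus
  \<open>w\<close> are the subtrees at the children of \<open>w\<close>. The other branch vertices
  share one component, so of any two children at least one has a subtree free of them.\<close>

lemma end_branch_free_child:
  assumes eb: "end_branch V T w" and rt: "rooted_tree V T w p d"
  obtains z where "z \<in> V" "z \<noteq> w" "p z = w"
    "\<And>x. x \<in> branches V T \<Longrightarrow> (x, z) \<notin> (up V w p)\<^sup>*"
proof -
  interpret rooted_tree V T w p d by (rule rt)
  have "3 \<le> card (T `` {w})"
    using eb by (simp add: end_branch_def branches_def nbr_deg_def)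
  then obtain z1 z2 where z: "z1 \<in> T `` {w}" "z2 \<in> T `` {w}" "z1 \<noteq> z2"
    by (metis (no_types, lifting) One_nat_def card_le_Suc0_iff_eq finite_nbrs not_less_eq_eq
        numeral_3_eq_3 Suc_leD)
  then have z1: "z1 \<in> V" "z1 \<noteq> w" "p z1 = w" and z2: "z2 \<in> V" "z2 \<noteq> w" "p z2 = w"
    using nbrs_root by auto
  have below_closed: "(b, z1) \<in> U\<^sup>*" if ab: "(a, b) \<in> delete_vertex T w" and a: "(a, z1) \<in> U\<^sup>*" for a b
  proof (cases "(b, a) \<in> U")
    case True
    with a show ?thesis by (simp add: converse_rtrancl_into_rtrancl)
  next
    case False
    with ab have b: "b = p a" "b \<noteq> w"
      by (auto simp: delete_vertex_def in_T_iff in_U_iff)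
    with z1 have "a \<noteq> z1" by blast
    with a b show ?thesis
      by (metis converse_rtranclE in_U_iff)
  qed
  have up_child: "y = z" if "(z, y) \<in> U\<^sup>*" "p z = w" "y \<noteq> w" for y z
    using that root_U by (metis converse_rtranclE in_U_iff)
  have "\<not> (x1 \<in> branches V T \<and> (x1, z1) \<in> U\<^sup>* \<and> x2 \<in> branches V T \<and> (x2, z2) \<in> U\<^sup>*)" for x1 x2
  proof
    assume *: "x1 \<in> branches V T \<and> (x1, z1) \<in> U\<^sup>* \<and> x2 \<in> branches V T \<and> (x2, z2) \<in> U\<^sup>*"
    then have "x1 \<noteq> w" "x2 \<noteq> w"
      using root_U z1 z2 by blast+
    then have "(x1, x2) \<in> (delete_vertex T w)\<^sup>*"
      using * eb by (simp add: end_branch_def)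
    then have "(x2, z1) \<in> U\<^sup>*"
    proof (induction rule: rtrancl_induct)
      case base
      show ?case using * by blast
    qed (rule below_closed)
    \<comment> \<open>Both are now ancestors of \<open>x2\<close> (or equal to it), and ancestors of
      one vertex form a chain; distinct children of the root are never comparable.\<close>
    then have "(z1, z2) \<in> U\<^sup>* \<or> (z2, z1) \<in> U\<^sup>*"
      using U_linear * by blast
    then show False
      using up_child z1 z2 z(3) by blast
  qed
  then show thesis
    using that z1 z2 by metis
qed

text \<open>The subtree at a free child \<open>z\<close> of \<open>w\<close> contains no branch
  vertex, and its deepest vertex \<open>v\<close> is a leaf. An edge of \<open>E\<close> from
  \<open>v\<close> to a branch vertex other than \<open>w\<close> would let the subtree move there,
  lowering the degree of \<open>w\<close>.\<close>

lemma end_branch_leaf: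
  assumes opt: "optimal V E T" and E: "sym E" "E \<subseteq> V \<times> V" and eb: "end_branch V T w"
    and min: "\<And>S. optimal V E S \<Longrightarrow> end_branch V S w \<Longrightarrow> nbr_deg T w \<le> nbr_deg S w"
  obtains v where "v \<in> leaves V T" "E `` {v} \<inter> branches V T \<subseteq> {w}"
proof -
  have T: "tree_on V T" "T \<subseteq> E"
    using opt by (auto simp: optimal_def)
  have w: "w \<in> V" "w \<in> branches V T"
    using eb by (auto simp: end_branch_def branches_def)
  obtain p d where rt: "rooted_tree V T w p d"
    using tree_on_rooted_tree T w by metis
  then interpret rooted_tree V T w p d .
  obtain z where z: "z \<in> V" "z \<noteq> w" "p z = w"
    and free: "\<And>x. x \<in> branches V T \<Longrightarrow> (x, z) \<notin> U\<^sup>*"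
    using end_branch_free_child[OF eb rt] by metis
  define D where "D = {a \<in> V. (a, z) \<in> U\<^sup>*}"
  have D: "finite D" "D \<noteq> {}"
    using z tree_on_props(1)[OF T(1)] by (auto simp: D_def)
  then obtain v where v: "v \<in> D" and "d v = Max (d ` D)"
    using Max_in[of "d ` D"] by (metis (mono_tags, lifting) finite_imageI imageE image_is_empty)
  then have max: "d x \<le> d v" if "x \<in> D" for x
    using D that by simp
  have vz: "(v, z) \<in> U\<^sup>*" and vV: "v \<in> V"
    using v by (auto simp: D_def)
  have vw: "v \<noteq> w"
    using root_U vz z by blast
  have "{y \<in> V. y \<noteq> w \<and> p y = v} = {}"
  proof -
    have False if y: "y \<in> V" "y \<noteq> w" "p y = v" for y
    proof -
      have "(y, v) \<in> U"
        using y by (simp add: in_U_iff)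
      then have "y \<in> D"
        using vz y by (auto simp: D_def intro: converse_rtrancl_into_rtrancl)
      then show False
        using max parent y by fastforce
    qed
    then show ?thesis by blast
  qed
  then have "T `` {v} = {p v}"
    using nbrs[OF vV vw] by (simp only:)
  then have vL: "v \<in> leaves V T"
    using vV by (simp add: leaves_def nbr_deg_def)
  have "x = w" if x: "x \<in> E `` {v}" "x \<in> branches V T" for x
  proof (rule ccontr)
    assume xw: "x \<noteq> w"
    have xV: "x \<in> V" and xz: "(x, z) \<notin> U\<^sup>*"
      using x free by (auto simp: branches_def)
    then have xnz: "x \<noteq> z" by blast
    let ?S = "T - edge z (p z) \<union> edge x v"
    have S: "tree_on V ?S"
      using exchange(1)[OF z(1,2) vz xV xz] .
    have deg: "nbr_deg ?S c + of_bool (c = z \<or> c = w) = nbr_deg T c + of_bool (c = x \<or> c = v)" for c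
      using exchange(2)[OF z(1,2) vz xV xz] z(3) by simp
    have SE: "?S \<subseteq> E"
      using T x E by (auto simp: edge_def sym_def)
    have deg1: "nbr_deg T v = 1" "3 \<le> nbr_deg T w" "3 \<le> nbr_deg T x"
      using vL w x by (auto simp: leaves_def branches_def)
    have BS: "branches V ?S \<subseteq> branches V T"
    proof
      fix c assume "c \<in> branches V ?S"
      then show "c \<in> branches V T"
        using deg[of c] deg1 by (auto simp: branches_def of_bool_def split: if_splits)
    qed
    have LS: "leaves V ?S \<subseteq> insert z (leaves V T - {v})"
    proof
      fix c assume "c \<in> leaves V ?S"
      then show "c \<in> insert z (leaves V T - {v})"
        using deg[of c] deg1 xw vw xnz by (auto simp: leaves_def of_bool_def split: if_splits)
    qed
    have fin: "finite (leaves V T)"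
      using T finite_leaves by blast
    have "card (leaves V ?S) \<le> card (insert z (leaves V T - {v}))"
      using fin LS by (intro card_mono) auto
    also have "\<dots> \<le> Suc (card (leaves V T - {v}))"
      using fin by (simp add: card_insert_if)
    also have "\<dots> = card (leaves V T)"
      using fin vL by (rule card_Suc_Diff1)
    finally have optS: "optimal V E ?S"
      using optimal_transfer[OF opt S SE BS] by blast
    \<comment> \<open>The removed edge ends at \<open>w\<close>, so nothing is lost away from
      \<open>w\<close>. The branch set is unchanged by optimality, hence \<open>w\<close> is still
      an end branch.\<close>
    have "delete_vertex T w \<subseteq> delete_vertex ?S w"
      using z(3) by (auto simp: delete_vertex_def in_edge_iff)
    then have "(delete_vertex T w)\<^sup>* \<subseteq> (delete_vertex ?S w)\<^sup>*"
      by (rule rtrancl_mono)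
    then have "end_branch V ?S w"
      using eb optimal_exchange(1)[OF opt S SE BS] by (auto simp: end_branch_def)
    then have "nbr_deg T w \<le> nbr_deg ?S w"
      using min optS by blast
    then show False
      using deg[of w] xw vw by simp
  qed
  then show thesis
    by (intro that[OF vL]) blast
qed

section \<open>Counting disjoint vertex sets\<close>

lemma optimal_degree_sum:
  assumes opt: "optimal V E T" and E: "sym E" "irrefl E" "E \<subseteq> V \<times> V"
    and B: "branches V T \<noteq> {}"
    and u: "u \<in> leaves V T" and v: "v \<in> leaves V T" and uv: "u \<noteq> v"
    and vw: "E `` {v} \<inter> branches V T \<subseteq> {w}"
  shows "card (E `` {u}) + card (E `` {v}) + card (leaves V T - {u}) + card (branches V T - {w}) \<le> card V"
proof -
  have T: "tree_on V T" "T \<subseteq> E"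
    using opt by (auto simp: optimal_def)
  have uV: "u \<in> V" "v \<in> V" "nbr_deg T u = 1"
    using u v by (auto simp: leaves_def)
  obtain p d where rt: "rooted_tree V T u p d"
    using tree_on_rooted_tree T uV by metis
  then interpret rooted_tree V T u p d .
  \<comment> \<open>\<open>?L\<close> omits \<open>u\<close>, which is the parent of its own tree
    neighbour and so lies in \<open>?A\<close>; \<open>?B\<close> omits \<open>w\<close>, which may
    be adjacent to \<open>v\<close>.\<close>
  let ?A = "p ` (E `` {u})" and ?N = "E `` {v}" and ?L = "leaves V T - {u}" and ?B = "branches V T - {w}"
  have nb: "x \<in> V" "x \<noteq> u" if "(u, x) \<in> E" for x
    using E that by (auto simp: irrefl_def)
  have A: "p x \<in> V" "p x = u \<or> nbr_deg T (p x) = 2" "(v, p x) \<notin> E" if x: "(u, x) \<in> E" for x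
  proof -
    show "p x \<in> V"
      using parent nb x by blast
    show deg2: "p x = u \<or> nbr_deg T (p x) = 2"
      using optimal_parent_of_nbr(1)[OF opt E rt u x] by blast
    show "(v, p x) \<notin> E"
    proof (cases "p x = u")
      case True
      then show ?thesis
        using optimal_leaves_nonadjacent[OF opt E(1) B v u] uv by simp
    next
      case False
      \<comment> \<open>In the modified optimal tree both \<open>p x\<close> and \<open>v\<close>
        are leaves, so nonadjacency of leaves applies to them.\<close>
      then obtain S where S: "optimal V E S" "branches V S = branches V T"
        "leaves V S = insert (p x) (leaves V T - {u})"
        using optimal_parent_of_nbr(2)[OF opt E rt u x] by blast
      have "v \<noteq> p x"
        using False deg2 v by (auto simp: leaves_def)
      then show ?thesis
        using optimal_leaves_nonadjacent[OF S(1) E(1), of v "p x"] S B v uv by simp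
    qed
  qed
  \<comment> \<open>Each such parent is the root, which is a leaf, or has degree 2; either way it
    has only one child.\<close>
  have "inj_on p (E `` {u})"
  proof (rule inj_onI)
    fix x y assume "x \<in> E `` {u}" "y \<in> E `` {u}" and eq: "p x = p y"
    then have xy: "(u, x) \<in> E" "(u, y) \<in> E" by auto
    show "x = y"
    proof (cases "p x = u")
      case True
      then show ?thesis
        using leaf_root_child_unique[OF u] nb xy eq by metis
    next
      case False
      then have "nbr_deg T (p x) \<le> 2"
        using A(2)[OF xy(1)] by simp
      then show ?thesis
        using False A(1)[OF xy(1)] nb[OF xy(1)] nb[OF xy(2)] eq
        by (intro child_unique[of "p x" x y]) simp_all
    qed
  qed
  then have cA: "card ?A = card (E `` {u})"
    by (rule card_image)
  have NL: "?N \<inter> ?L = {}"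
    using optimal_leaves_nonadjacent[OF opt E(1) B v] E(2) by (auto simp: irrefl_def)
  have AN: "?A \<inter> ?N = {}"
    using A(3) by auto
  have AL: "?A \<inter> ?L = {}"
    using A(2) by (fastforce simp: leaves_def)
  have AB: "?A \<inter> ?B = {}"
    using A(2) uV by (fastforce simp: branches_def)
  have NB: "?N \<inter> ?B = {}"
    using vw by blast
  have LB: "?L \<inter> ?B = {}"
    by (auto simp: leaves_def branches_def)
  have sub: "?A \<subseteq> V" "?N \<subseteq> V" "?L \<subseteq> V" "?B \<subseteq> V"
    using A(1) E by (auto simp: leaves_def branches_def)
  have fV: "finite V"
    using tree_on_props(1)[OF T(1)] .
  have fin: "finite ?A" "finite ?N" "finite ?L" "finite ?B"
    using sub fV by (meson finite_subset)+
  have "card (?A \<union> ?N \<union> ?L \<union> ?B) = card (?A \<union> ?N \<union> ?L) + card ?B"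
    using fin AB NB LB by (intro card_Un_disjoint) blast+
  also have "card (?A \<union> ?N \<union> ?L) = card (?A \<union> ?N) + card ?L"
    using fin AL NL by (intro card_Un_disjoint) blast+
  also have "card (?A \<union> ?N) = card ?A + card ?N"
    using fin AN by (intro card_Un_disjoint) blast+
  finally have "card ?A + card ?N + card ?L + card ?B = card (?A \<union> ?N \<union> ?L \<union> ?B)"
    by simp
  also have "\<dots> \<le> card V"
    using sub fV by (intro card_mono) blast+
  finally show ?thesis
    using cA by simp
qed

text \<open>The lexicographic minimum is found in two stages: first the least number
  \<open>b\<close> of branch vertices, then the fewest leaves among trees attaining
  \<open>b\<close>.\<close>

lemma optimal_exists:
  assumes "connected_on V E"
  obtains T where "optimal V E T"
proof -
  let ?P = "\<lambda>T. tree_on V T \<and> T \<subseteq> E"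
  obtain T0 where T0: "?P T0"
    using connected_on_spanning_tree assms by metis
  define b where "b = (LEAST n. \<exists>T. ?P T \<and> card (branches V T) = n)"
  have "\<exists>T. ?P T \<and> card (branches V T) = b"
    unfolding b_def by (rule LeastI_ex) (use T0 in blast)
  then obtain T1 where T1: "?P T1 \<and> card (branches V T1) = b" ..
  have b: "b \<le> card (branches V S)" if "?P S" for S
    unfolding b_def using that by (intro Least_le) blast
  obtain T where T: "?P T \<and> card (branches V T) = b"
    and l: "\<And>S. ?P S \<and> card (branches V S) = b \<Longrightarrow> card (leaves V T) \<le> card (leaves V S)"
    using ex_has_least_nat[of "\<lambda>T. ?P T \<and> card (branches V T) = b" T1 "\<lambda>T. card (leaves V T)"] T1
    by blast
  have "optimal V E T"
    using T b l by (auto simp: optimal_def)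
  then show thesis by (rule that)
qed

lemma spanning_tree_few_branches:
  assumes conn: "connected_on V E"
  obtains T where "tree_on V T" "T \<subseteq> E"
    "branches V T = {} \<or> (\<exists>u\<in>V. \<exists>v\<in>V. u \<noteq> v \<and> (u, v) \<notin> E \<and>
       card (E `` {u}) + card (E `` {v}) + 2 * card (branches V T) \<le> card V)"
proof -
  have E: "sym E" "irrefl E" "E \<subseteq> V \<times> V"
    using conn by (auto simp: connected_on_def)
  obtain T0 where T0: "optimal V E T0"
    using optimal_exists conn by metis
  show thesis
  proof (cases "branches V T0 = {}")
    case True
    then show thesis
      using T0 that by (auto simp: optimal_def)
  next
    case False
    then obtain w0 where w0: "end_branch V T0 w0"
      using end_branch_exists T0 by (metis optimal_def)
    \<comment> \<open>The minimum is taken over pairs, so the degree of \<open>w\<close> is compared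
      across all optimal trees, as \<open>end_branch_leaf\<close> requires.\<close>
    let ?P = "\<lambda>(T, w). optimal V E T \<and> end_branch V T w"
    obtain q where q: "?P q" and min: "\<And>q'. ?P q' \<Longrightarrow> (\<lambda>(T, w). nbr_deg T w) q \<le> (\<lambda>(T, w). nbr_deg T w) q'"
      using ex_has_least_nat[of ?P "(T0, w0)" "\<lambda>(T, w). nbr_deg T w"] T0 w0 by blast
    obtain T w where Tw: "q = (T, w)" by (cases q)
    have opt: "optimal V E T" and eb: "end_branch V T w"
      using q Tw by auto
    have T: "tree_on V T" "T \<subseteq> E"
      using opt by (auto simp: optimal_def)
    have B: "branches V T \<noteq> {}" and wB: "w \<in> branches V T"
      using eb by (auto simp: end_branch_def)
    have "nbr_deg T w \<le> nbr_deg S w" if "optimal V E S" "end_branch V S w" for S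
      using min[of "(S, w)"] that Tw by simp
    then obtain v where v: "v \<in> leaves V T" "E `` {v} \<inter> branches V T \<subseteq> {w}"
      using end_branch_leaf[OF opt E(1,3) eb] by metis
    have fV: "finite V"
      using tree_on_props(1)[OF T(1)] .
    have "{v, w} \<subseteq> V" "v \<noteq> w"
      using v wB by (auto simp: leaves_def branches_def)
    then have "2 \<le> card V"
      using card_mono[OF fV, of "{v, w}"] by simp
    then have L: "card (branches V T) + 2 \<le> card (leaves V T)"
      using card_leaves_ge T by blast
    have fB: "finite (branches V T)" and fL: "finite (leaves V T)"
      using finite_branches finite_leaves T by blast+
    have "\<not> leaves V T \<subseteq> {v}"
      using L card_mono[of "{v}" "leaves V T"] by auto
    then obtain u where u: "u \<in> leaves V T" "u \<noteq> v"
      by blast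
    have "card (E `` {u}) + card (E `` {v}) + card (leaves V T - {u}) + card (branches V T - {w}) \<le> card V"
      using optimal_degree_sum[OF opt E B u(1) v(1) u(2) v(2)] .
    moreover have "card (leaves V T - {u}) = card (leaves V T) - 1"
      using u by simp
    moreover have "card (branches V T - {w}) = card (branches V T) - 1"
      using wB by simp
    moreover have "0 < card (branches V T)"
      using B fB by (simp add: card_gt_0_iff)
    \<comment> \<open>With \<open>b\<close> branch vertices, the leaves other than \<open>u\<close>
      number at least \<open>b + 1\<close> and the branch vertices other than \<open>w\<close>
      exactly \<open>b - 1\<close>, together at least \<open>2 b\<close>.\<close>
    ultimately have "card (E `` {u}) + card (E `` {v}) + 2 * card (branches V T) \<le> card V"
      using L by linarith
    moreover have "(u, v) \<notin> E"
      using optimal_leaves_nonadjacent[OF opt E(1) B u(1) v(1) u(2)] .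
    moreover have "u \<in> V" "v \<in> V"
      using u v by (auto simp: leaves_def)
    ultimately show thesis
      using T u(2) by (intro that[of T]) blast+
  qed
qed

section \<open>Translation to pair graphs\<close>

lemma pcas_end_in_verts: "pcas b es a \<Longrightarrow> a \<in> set (pawalk_verts b es)"
  by (induction es arbitrary: b) auto

lemma pcas_arc_in_verts:
  "pcas b es a \<Longrightarrow> (x, y) \<in> set es \<Longrightarrow> x \<in> set (pawalk_verts b es) \<and> y \<in> set (pawalk_verts b es)"
proof (induction es arbitrary: b)
  case (Cons e es)
  then show ?case
    by (cases es) auto
qed simp

lemma pcas_rtrancl: "pcas b es a \<Longrightarrow> set es \<subseteq> R \<Longrightarrow> (b, a) \<in> R\<^sup>*"
  by (induction es arbitrary: b) (auto intro: converse_rtrancl_into_rtrancl)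

text \<open>After its first arc \<open>ab\<close>, a cycle returns from \<open>b\<close> to
  \<open>a\<close> without that edge, although the edge is a bridge.\<close>

lemma tree_on_no_cycle:
  assumes T: "tree_on V T"
  shows "\<not> (pre_digraph.cycle (with_proj \<lparr>pverts = V, parcs = T\<rparr>) es \<and> 3 \<le> length es)"
proof
  assume *: "pre_digraph.cycle (with_proj \<lparr>pverts = V, parcs = T\<rparr>) es \<and> 3 \<le> length es"
  then obtain u where u: "set es \<subseteq> T" "pcas u es u" "distinct (tl (pawalk_verts u es))" "3 \<le> length es"
    by (auto simp: pre_digraph.cycle_def pre_digraph.awalk_def cas_with_proj_eq awalk_verts_with_proj_eq)
  \<comment> \<open>The third arc \<open>g\<close> guarantees \<open>c \<noteq> a\<close>, so the
    second arc is not the first one reversed.\<close>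
  then obtain a b c g fs gs where es: "es = (a, b) # (b, c) # fs" "fs = g # gs"
    by (auto simp: numeral_3_eq_3 Suc_le_length_iff)
  have fs: "pcas c fs a" and a: "u = a"
    using u(2) es by auto
  have dist: "b \<notin> set (pawalk_verts c fs)" "distinct (pawalk_verts c fs)"
    using u(3) es by auto
  have "a \<in> set (pawalk_verts (snd g) gs)"
    using fs es pcas_end_in_verts by auto
  then have "c \<noteq> a"
    using dist(2) es fs by auto
  moreover have "c \<noteq> b"
    using dist(1) es fs by auto
  \<comment> \<open>The vertices of a cycle are distinct, so the remaining arcs do not touch
    \<open>b\<close>.\<close>
  moreover have "set fs \<inter> edge a b = {}"
    using pcas_arc_in_verts[OF fs] dist(1) by (auto simp: edge_def)
  moreover have "set ((b, c) # fs) \<subseteq> T"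
    using u(1) es by simp
  ultimately have "set ((b, c) # fs) \<subseteq> T - edge a b"
    by (auto simp: in_edge_iff)
  then have "(b, a) \<in> (T - edge a b)\<^sup>*"
    using pcas_rtrancl[of b "(b, c) # fs" a] fs by simp
  moreover have "sym (T - edge a b)"
    by (rule sym_Diff_edge[OF tree_on_props(4)[OF T]])
  moreover have "(a, b) \<in> T"
    using u(1) es by simp
  ultimately show False
    using tree_on_bridge[OF T] rtrancl_symD by metis
qed

text \<open>The library asks for strong connectedness of the symmetric closure, with reachability
  confined to the vertex set. The arcs are already symmetric and stay inside that set, so both
  notions agree.\<close>

lemma connected_on_pair_graph:
  assumes "pair_graph G"
  shows "Digraph_Component.connected (with_proj G) \<longleftrightarrow> connected_on (pverts G) (parcs G)"
proof -
  interpret pair_graph G by fact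
  have GV: "parcs G \<subseteq> pverts G \<times> pverts G"
    using wellformed' by auto
  have G: "finite (pverts G)" "sym (parcs G)" "irrefl (parcs G)"
    using pair_finite_verts pair_sym_arcs no_loops' by (auto simp: symmetric_def irrefl_def)
  have symm: "parcs (mk_symmetric (with_proj G)) = parcs G"
    using adj_mk_symmetric_eq pair_sym_arcs by simp
  have "(u, v) \<in> rtrancl_on (pverts G) (parcs G) \<longleftrightarrow> (u, v) \<in> (parcs G)\<^sup>*"
    if "u \<in> pverts G" "v \<in> pverts G" for u v
  proof
    assume "(u, v) \<in> (parcs G)\<^sup>*"
    then show "(u, v) \<in> rtrancl_on (pverts G) (parcs G)"
      using that GV by (intro rtrancl_consistent_rtrancl_on) auto
  qed (rule rtrancl_on_rtranclI)
  then show ?thesis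
    using G GV symm
    by (auto simp: connected_def strongly_connected_def connected_on_def reachable_def)
qed

lemma tree_on_pair_graph:
  assumes "tree_on V T"
  shows "pair_graph \<lparr>pverts = V, parcs = T\<rparr>"
  using tree_on_props[OF assms] by unfold_locales (auto simp: symmetric_def irrefl_def)

lemma tree_on_undirected_spanning_tree:
  assumes G: "pair_graph G" and T: "tree_on (pverts G) T" "T \<subseteq> parcs G"
  shows "undirected_spanning_tree \<lparr>pverts = pverts G, parcs = T\<rparr> G"
proof -
  let ?T = "\<lparr>pverts = pverts G, parcs = T\<rparr>"
  interpret G: pair_graph G by fact
  interpret T: pair_graph ?T using T(1) by (rule tree_on_pair_graph)
  have "Digraph_Component.connected (with_proj ?T)"
    using connected_on_pair_graph[OF T.pair_graph] T(1) by (simp add: tree_on_def)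
  moreover have "spanning (with_proj ?T) (with_proj G)"
    using T(2) G.wf_digraph T.wf_digraph by (simp add: spanning_def subgraph_def compatible_def)
  ultimately show ?thesis
    using tree_on_no_cycle[OF T(1)] T.pair_graph
    by (auto simp: undirected_spanning_tree_def undirected_tree_def)
qed

lemma deg_eq_card_Image: "deg G v = card (parcs G `` {v})"
proof -
  have "out_arcs (with_proj G) v = Pair v ` (parcs G `` {v})"
    by (auto simp: out_arcs_def)
  then show ?thesis
    by (simp add: out_degree_def card_image inj_on_def)
qed

theorem theorem2:
  fixes G :: "'a pair_pre_digraph" and n k :: nat
  assumes "pair_graph G"
    and "Digraph_Component.connected (with_proj G)"
    and "card (pverts G) = n"
    and "k > 0"
    and "sigma2 G \<ge> ereal (real n - real k + 1)"
  shows "\<exists>T. undirected_spanning_tree T G \<and>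
    real (card (branch_vertices T)) \<le> (real k - 1) / 2"
proof -
  let ?V = "pverts G" and ?E = "parcs G"
  have "connected_on ?V ?E"
    using assms(1,2) connected_on_pair_graph by blast
  then obtain T where T: "tree_on ?V T" "T \<subseteq> ?E"
    and few: "branches ?V T = {} \<or> (\<exists>u\<in>?V. \<exists>v\<in>?V. u \<noteq> v \<and> (u, v) \<notin> ?E \<and>
       card (?E `` {u}) + card (?E `` {v}) + 2 * card (branches ?V T) \<le> card ?V)"
    by (rule spanning_tree_few_branches)
  let ?T = "\<lparr>pverts = ?V, parcs = T\<rparr>"
  have BT: "branch_vertices ?T = branches ?V T"
    by (simp add: branch_vertices_def branches_def deg_eq_card_Image nbr_deg_def)
  have "real (card (branches ?V T)) \<le> (real k - 1) / 2"
    using few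
  proof
    assume "branches ?V T = {}"
    \<comment> \<open>Positivity of \<open>k\<close> makes the bound nonnegative.\<close>
    then show ?thesis
      using assms(4) by simp
  next
    assume "\<exists>u\<in>?V. \<exists>v\<in>?V. u \<noteq> v \<and> (u, v) \<notin> ?E \<and>
       card (?E `` {u}) + card (?E `` {v}) + 2 * card (branches ?V T) \<le> card ?V"
    then obtain u v where uv: "u \<in> ?V" "v \<in> ?V" "u \<noteq> v" "(u, v) \<notin> ?E"
      and le: "deg G u + deg G v + 2 * card (branches ?V T) \<le> card ?V"
      unfolding deg_eq_card_Image by blast
    have "sigma2 G \<le> ereal (real (deg G u + deg G v))"
      unfolding sigma2_def using uv by (intro Inf_lower) blast
    then have "ereal (real n - real k + 1) \<le> ereal (real (deg G u + deg G v))"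
      using assms(5) by (rule order_trans[rotated])
    then have "real n - real k + 1 \<le> real (deg G u + deg G v)"
      by simp
    \<comment> \<open>Combined with the lower bound \<open>n - k + 1\<close> on the degree sum, this
      leaves at most \<open>k - 1\<close> for twice the number of branch vertices.\<close>
    moreover have "real (deg G u + deg G v) + 2 * real (card (branches ?V T)) \<le> real n"
      using le assms(3) by linarith
    ultimately show ?thesis
      by simp
  qed
  then show ?thesis
    using tree_on_undirected_spanning_tree[OF assms(1) T] BT by metis
qed

end
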